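(* Let $\lambda_0\in\mathbb{R}$. Assume that system (S$_\lambda$) of the context satisfies: (i) (S$_\lambda$) is disconjugate on $\mathcal{I}$ with respect to $\lambda=\lambda_0$; and (ii) (S$_\lambda$) is identically normal on $\mathcal{I}$. Then for any integer $t_1\ge 1$, system (S$_\lambda$) with $\lambda=\lambda_0$ has a recessive solution $\tilde Y=(\tilde U;\tilde V)$ which satisfies $\tilde U(t_1)=I_n$ and $\tilde U(t)$ is non-singular for all $t\ge t_1$.
   Context: Setting. $\mathcal{I}=\{0,1,2,\dots\}$, $\Delta u(t)=u(t+1)-u(t)$, $M^*$ is the conjugate transpose of $M$. For $t\in\mathcal{I}$, $A(t)$ is an $n\times n$ complex matrix with $I_n-A(t)$ invertible, and $B(t),C(t),W(t)$ are $n\times n$ Hermitian matrices with $B(t)\ge 0$, $W(t)\ge 0$. For $\lambda\in\mathbb{C}$, (S$_\lambda$) is the discrete linear Hamiltonian system $$\Delta u(t)=A(t)u(t+1)+B(t)v(t),\qquad \Delta v(t)=(C(t)-\lambda W(t))u(t+1)-A^*(t)v(t),\quad t\in\mathcal{I}.$$ A vector solution is written $y=(u;v)$, with $u(t),v(t)\in\mathbb{C}^n$ for $t\in\mathcal I$; a $2n\times n$ matrix-valued solution is written $Y=(U;V)$ with $n\times n$ blocks $U,V$. Put $\tilde A(t)=(I_n-A(t))^{-1}$ and $J=\begin{pmatrix}0&-I_n\\ I_n&0\end{pmatrix}$. Prepared and recessive solutions. A matrix solution $Y$ is prepared if $Y^*(t)JY(t)\equiv 0$. A prepared solution $Y=(U;V)$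 is recessive (or principal) if, whenever $Y_1=(U_1;V_1)$ is a ($2n\times n$ matrix-valued) solution of the same system with $Y^*(t)JY_1(t)\equiv C$ on $\mathcal{I}$ for a non-singular constant matrix $C$, there exists $s_1\in\mathcal{I}$ such that $U_1(t)$ is non-singular for $t\ge s_1$ and $\lim_{t\to\infty}U_1^{-1}(t)U(t)=0$. Disconjugacy. $B^\dagger$ denotes the Moore–Penrose inverse of $B$. A solution $y=(u;v)$ has a generalized zero at $t=0$ if $u(0)=0$, and at $t\ge 1$ if $u(t-1)\ne 0$, $u(t)\in\mathrm{Ran}(\tilde A(t-1)B(t-1))$ and $u^*(t-1)B^\dagger(t-1)(I_n-A(t-1))u(t)\le 0$. (S$_\lambda$) is disconjugate on $\mathcal{I}$ with respect to $\lambda=\lambda_0\in\mathbb{R}$ if every solution of (S$_\lambda$) with $\lambda=\lambda_0$ has at most one generalized zero on $\mathcal{I}$. Normality. For a subinterval $\mathcal{I}_1$ of $\mathcal{I}$, let $\Lambda(\mathcal{I}_1)$ be the vector space of $\mathbb{C}^n$-valued functions $v$ satisfying $\Delta v(t)=-A^*(t)v(t)$ and $B(t)v(t)=0$ on $\mathcal{I}_1$. (S$_\lambda$) is normal on $\mathcal{I}_1$ if $\Lambda(\mathcal{I}_1)=\{0\}$, and identically normal on $\mathcal{I}$ if it is normal on every subinterval of $\mathcal{I}$. *)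

theory Defs
  imports "HOL-Analysis.Analysis" "HOL-Library.Complex_Order"
begin

text \<open>
  Inequalities between complex numbers are those of \<^theory>\<open>HOL-Library.Complex_Order\<close>:
  \<open>z \<le> 0\<close> means that \<open>z\<close> is real and nonpositive.
\<close>

definition conj_transpose :: "complex^'c^'r \<Rightarrow> complex^'r^'c" where
  "conj_transpose M = (\<chi> i j. cnj (M $ j $ i))"

text \<open>The scalar \<open>x\<^sup>* y\<close>.\<close>

definition cdot :: "complex^'n \<Rightarrow> complex^'n \<Rightarrow> complex" where
  "cdot x y = (\<Sum>i\<in>UNIV. cnj (x $ i) * y $ i)"

definition hermitian :: "complex^'n^'n \<Rightarrow> bool" where
  "hermitian M \<longleftrightarrow> conj_transpose M = M"

definition nonneg_definite :: "complex^'n^'n \<Rightarrow> bool" where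
  "nonneg_definite M \<longleftrightarrow> hermitian M \<and> (\<forall>x. 0 \<le> cdot x (M *v x))"

definition is_moore_penrose :: "complex^'c^'r \<Rightarrow> complex^'r^'c \<Rightarrow> bool" where
  "is_moore_penrose M X \<longleftrightarrow>
     M ** X ** M = M \<and> X ** M ** X = X \<and>
     conj_transpose (M ** X) = M ** X \<and> conj_transpose (X ** M) = X ** M"

text \<open>The four Penrose equations have exactly one solution for every complex matrix.\<close>

definition moore_penrose :: "complex^'c^'r \<Rightarrow> complex^'r^'c" where
  "moore_penrose M = (THE X. is_moore_penrose M X)"

text \<open>
  Block matrices of height \<open>2n\<close> have rows indexed by \<open>'n + 'n\<close>; \<open>Inl\<close> is the upper block.
\<close>

definition stack :: "complex^'n^'n \<Rightarrow> complex^'n^'n \<Rightarrow> complex^'n^('n::finite + 'n)" where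
  "stack U V = (\<chi> i. case i of Inl a \<Rightarrow> U $ a | Inr b \<Rightarrow> V $ b)"

definition J_mat :: "complex^('n::finite + 'n)^('n + 'n)" where
  "J_mat = (\<chi> i j. case (i, j) of
       (Inl a, Inr b) \<Rightarrow> - (mat 1 :: complex^'n^'n) $ a $ b
     | (Inr a, Inl b) \<Rightarrow> (mat 1 :: complex^'n^'n) $ a $ b
     | _ \<Rightarrow> 0)"

text \<open>
  The interval \<open>{0, 1, 2, \<dots>}\<close> is the type \<^typ>\<open>nat\<close>, and \<open>\<Delta> f t\<close> is \<open>f (t + 1) - f t\<close>.
  In \<open>C t - lam W t\<close> the scalar multiple is written as multiplication by \<open>mat lam\<close>, that is \<open>lam I\<close>.
\<close>

definition vec_solution ::
  "(nat \<Rightarrow> complex^'n^'n) \<Rightarrow> (nat \<Rightarrow> complex^'n^'n) \<Rightarrow> (nat \<Rightarrow> complex^'n^'n) \<Rightarrow>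
   (nat \<Rightarrow> complex^'n^'n) \<Rightarrow> complex \<Rightarrow> (nat \<Rightarrow> complex^'n) \<Rightarrow> (nat \<Rightarrow> complex^'n) \<Rightarrow> bool" where
  "vec_solution A B C W lam u v \<longleftrightarrow>
     (\<forall>t. u (t + 1) - u t = A t *v u (t + 1) + B t *v v t \<and>
          v (t + 1) - v t = (C t - mat lam ** W t) *v u (t + 1) - conj_transpose (A t) *v v t)"

definition mat_solution ::
  "(nat \<Rightarrow> complex^'n^'n) \<Rightarrow> (nat \<Rightarrow> complex^'n^'n) \<Rightarrow> (nat \<Rightarrow> complex^'n^'n) \<Rightarrow>
   (nat \<Rightarrow> complex^'n^'n) \<Rightarrow> complex \<Rightarrow> (nat \<Rightarrow> complex^'n^'n) \<Rightarrow> (nat \<Rightarrow> complex^'n^'n) \<Rightarrow> bool" where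
  "mat_solution A B C W lam U V \<longleftrightarrow>
     (\<forall>t. U (t + 1) - U t = A t ** U (t + 1) + B t ** V t \<and>
          V (t + 1) - V t = (C t - mat lam ** W t) ** U (t + 1) - conj_transpose (A t) ** V t)"

definition prepared_solution ::
  "(nat \<Rightarrow> complex^'n^'n) \<Rightarrow> (nat \<Rightarrow> complex^'n^'n) \<Rightarrow> (nat \<Rightarrow> complex^'n^'n) \<Rightarrow>
   (nat \<Rightarrow> complex^'n^'n) \<Rightarrow> complex \<Rightarrow> (nat \<Rightarrow> complex^'n^'n) \<Rightarrow> (nat \<Rightarrow> complex^'n^'n) \<Rightarrow> bool" where
  "prepared_solution A B C W lam U V \<longleftrightarrow>
     mat_solution A B C W lam U V \<and>
     (\<forall>t. conj_transpose (stack (U t) (V t)) ** J_mat ** stack (U t) (V t) = 0)"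

definition recessive_solution ::
  "(nat \<Rightarrow> complex^'n^'n) \<Rightarrow> (nat \<Rightarrow> complex^'n^'n) \<Rightarrow> (nat \<Rightarrow> complex^'n^'n) \<Rightarrow>
   (nat \<Rightarrow> complex^'n^'n) \<Rightarrow> complex \<Rightarrow> (nat \<Rightarrow> complex^'n^'n) \<Rightarrow> (nat \<Rightarrow> complex^'n^'n) \<Rightarrow> bool" where
  "recessive_solution A B C W lam U V \<longleftrightarrow>
     prepared_solution A B C W lam U V \<and>
     (\<forall>U\<^sub>1 V\<^sub>1 K.
        mat_solution A B C W lam U\<^sub>1 V\<^sub>1 \<and> invertible K \<and>
        (\<forall>t. conj_transpose (stack (U t) (V t)) ** J_mat ** stack (U\<^sub>1 t) (V\<^sub>1 t) = K) \<longrightarrow>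
        (\<exists>s\<^sub>1. (\<forall>t\<ge>s\<^sub>1. invertible (U\<^sub>1 t)) \<and>
              (\<lambda>t. matrix_inv (U\<^sub>1 t) ** U t) \<longlonglongrightarrow> 0))"

definition generalized_zero ::
  "(nat \<Rightarrow> complex^'n^'n) \<Rightarrow> (nat \<Rightarrow> complex^'n^'n) \<Rightarrow> (nat \<Rightarrow> complex^'n) \<Rightarrow> nat \<Rightarrow> bool" where
  "generalized_zero A B u t \<longleftrightarrow>
     (if t = 0 then u 0 = 0
      else u (t - 1) \<noteq> 0 \<and>
           u t \<in> range (\<lambda>x. (matrix_inv (mat 1 - A (t - 1)) ** B (t - 1)) *v x) \<and>
           cdot (u (t - 1))
             ((moore_penrose (B (t - 1)) ** (mat 1 - A (t - 1))) *v u t) \<le> 0)"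

definition disconjugate ::
  "(nat \<Rightarrow> complex^'n^'n) \<Rightarrow> (nat \<Rightarrow> complex^'n^'n) \<Rightarrow> (nat \<Rightarrow> complex^'n^'n) \<Rightarrow>
   (nat \<Rightarrow> complex^'n^'n) \<Rightarrow> real \<Rightarrow> bool" where
  "disconjugate A B C W lam0 \<longleftrightarrow>
     (\<forall>u v. vec_solution A B C W (of_real lam0) u v \<longrightarrow>
        (\<forall>s t. generalized_zero A B u s \<and> generalized_zero A B u t \<longrightarrow> s = t))"

text \<open>
  The equations on \<open>I\<^sub>1\<close> involve \<open>v\<close> at the points of \<open>I\<^sub>1\<close> and at their successors;
  elements of \<open>\<Lambda>(I\<^sub>1)\<close> are functions on those points, represented by their extension by zero.
\<close>

definition Lambda_space ::
  "(nat \<Rightarrow> complex^'n^'n) \<Rightarrow> (nat \<Rightarrow> complex^'n^'n) \<Rightarrow> nat set \<Rightarrow> (nat \<Rightarrow> complex^'n) set" where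
  "Lambda_space A B I\<^sub>1 =
     {v. (\<forall>t\<in>I\<^sub>1. v (t + 1) - v t = - (conj_transpose (A t) *v v t) \<and> B t *v v t = 0) \<and>
         (\<forall>t. t \<notin> I\<^sub>1 \<union> Suc ` I\<^sub>1 \<longrightarrow> v t = 0)}"

definition normal_on ::
  "(nat \<Rightarrow> complex^'n^'n) \<Rightarrow> (nat \<Rightarrow> complex^'n^'n) \<Rightarrow> nat set \<Rightarrow> bool" where
  "normal_on A B I\<^sub>1 \<longleftrightarrow> Lambda_space A B I\<^sub>1 = {\<lambda>_. 0}"

text \<open>Subintervals are nonempty, and one-point intervals are included.\<close>

definition subinterval :: "nat set \<Rightarrow> bool" where
  "subinterval I\<^sub>1 \<longleftrightarrow> I\<^sub>1 \<noteq> {} \<and> (\<forall>a\<in>I\<^sub>1. \<forall>b\<in>I\<^sub>1. {a..b} \<subseteq> I\<^sub>1)"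

definition identically_normal ::
  "(nat \<Rightarrow> complex^'n^'n) \<Rightarrow> (nat \<Rightarrow> complex^'n^'n) \<Rightarrow> bool" where
  "identically_normal A B \<longleftrightarrow> (\<forall>I\<^sub>1. subinterval I\<^sub>1 \<longrightarrow> normal_on A B I\<^sub>1)"

end

theory Submission
  imports Defs
begin

text \<open>
  Normality on one-point intervals makes every \<open>B t\<close> positive definite. Let \<open>(U0; V0)\<close> be the solution with
  \<open>U0 0 = 0\<close>, \<open>V0 0 = I\<close>. Its columns combine to solutions with a generalized zero at \<open>0\<close>, so disconjugacy
  forbids any other one: \<open>U0 t\<close> is invertible and \<open>X t = (U0 t)\<^sup>* (B t)\<inverse> (I - A t) U0 (t+1)\<close> is positive
  definite for \<open>t \<ge> 1\<close>. Reduction of order writes every solution as \<open>U = U0 (M - S N)\<close> with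
  \<open>S = \<Sum> X\<inverse>\<close> increasing and \<open>M\<close>, \<open>N\<close> constant. The positive definite matrices \<open>S\<inverse>\<close> decrease strictly to
  a Hermitian \<open>T\<close>, and \<open>U = U0 (I - S T) = U0 S (S\<inverse> - T)\<close> is recessive: a solution \<open>U\<^sub>1\<close> with Wronskian \<open>K\<close>
  against it is \<open>U0 S ((S\<inverse> - T) M - K)\<close>, so \<open>U\<^sub>1\<inverse> U = ((S\<inverse> - T) M - K)\<inverse> (S\<inverse> - T)\<close> tends to \<open>0\<close>.
\<close>

section \<open>Complex matrices\<close>

lemma matrix_diff_ldistrib:
  fixes A :: "'a::ring_1^'m^'n" and B C :: "'a^'p^'m"
  shows "A ** (B - C) = A ** B - A ** C"
  by (vector matrix_matrix_mult_def sum_subtractf right_diff_distrib)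

lemma matrix_diff_rdistrib:
  fixes A B :: "'a::ring_1^'m^'n" and C :: "'a^'p^'m"
  shows "(A - B) ** C = A ** C - B ** C"
  by (vector matrix_matrix_mult_def sum_subtractf left_diff_distrib)

lemma matrix_add_rdistrib:
  fixes A B :: "'a::semiring_1^'m^'n" and C :: "'a^'p^'m"
  shows "(A + B) ** C = A ** C + B ** C"
  by (vector matrix_matrix_mult_def sum.distrib distrib_right)

lemma matrix_minus_left:
  fixes A :: "'a::ring_1^'m^'n" and B :: "'a^'p^'m"
  shows "(- A) ** B = - (A ** B)"
  by (vector matrix_matrix_mult_def sum_negf)

lemma matrix_minus_right:
  fixes A :: "'a::ring_1^'m^'n" and B :: "'a^'p^'m"
  shows "A ** (- B) = - (A ** B)"
  by (vector matrix_matrix_mult_def sum_negf)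

lemmas matrix_algebra = matrix_diff_ldistrib matrix_diff_rdistrib matrix_add_ldistrib
  matrix_add_rdistrib matrix_minus_left matrix_minus_right matrix_mul_assoc

lemma matrix_inv_right: "invertible A \<Longrightarrow> A ** matrix_inv A = mat 1"
  for A :: "'a::field^'n^'n"
  unfolding invertible_def matrix_inv_def by (rule someI2_ex) auto

lemma matrix_inv_left: "invertible A \<Longrightarrow> matrix_inv A ** A = mat 1"
  for A :: "'a::field^'n^'n"
  unfolding invertible_def matrix_inv_def by (rule someI2_ex) auto

lemma matrix_inv_cancel:
  fixes A :: "'a::field^'n^'n"
  assumes "invertible A"
  shows "matrix_inv A ** (A ** X) = X" "A ** (matrix_inv A ** X) = X"
    "X ** A ** matrix_inv A = X" "X ** matrix_inv A ** A = X"
  using assms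
  by (simp_all add: matrix_mul_assoc[symmetric] matrix_inv_left matrix_inv_right)
    (simp_all add: matrix_mul_assoc matrix_inv_left matrix_inv_right)

lemma matrix_inv_unique:
  fixes A :: "'a::field^'n^'n"
  assumes "A ** X = mat 1"
  shows "matrix_inv A = X"
  by (metis assms invertible_right_inverse matrix_inv_left matrix_mul_assoc matrix_mul_lid matrix_mul_rid)

lemma invertible_matrix_inv: "invertible A \<Longrightarrow> invertible (matrix_inv A)"
  for A :: "'a::field^'n^'n"
  using matrix_inv_left matrix_inv_right unfolding invertible_def by blast

lemma invertible_iff_kernel:
  fixes A :: "'a::field^'n^'n"
  shows "invertible A \<longleftrightarrow> (\<forall>x. A *v x = 0 \<longrightarrow> x = 0)"
  by (simp add: invertible_left_inverse matrix_left_invertible_ker)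

section \<open>Conjugate transposes and Hermitian matrices\<close>

lemma conj_transpose_mult: "conj_transpose (A ** B) = conj_transpose B ** conj_transpose A"
  by (simp add: conj_transpose_def matrix_matrix_mult_def vec_eq_iff mult.commute)

lemma conj_transpose_add: "conj_transpose (A + B) = conj_transpose A + conj_transpose B"
  by (simp add: conj_transpose_def vec_eq_iff)

lemma conj_transpose_diff: "conj_transpose (A - B) = conj_transpose A - conj_transpose B"
  by (simp add: conj_transpose_def vec_eq_iff)

lemma conj_transpose_zero: "conj_transpose 0 = 0"
  by (simp add: conj_transpose_def vec_eq_iff)

lemma conj_transpose_mat_of_real: "conj_transpose (mat (of_real r)) = mat (of_real r)"
  by (simp add: conj_transpose_def mat_def vec_eq_iff)

lemma conj_transpose_mat_1: "conj_transpose (mat 1) = mat 1"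
  using conj_transpose_mat_of_real[of 1] by simp

lemma conj_transpose_conj_transpose: "conj_transpose (conj_transpose A) = A"
  by (simp add: conj_transpose_def vec_eq_iff)

lemmas conj_transpose_simps = conj_transpose_mult conj_transpose_add conj_transpose_diff
  conj_transpose_zero conj_transpose_mat_1 conj_transpose_conj_transpose

text \<open>Needed to see that the scalar multiple \<open>mat (of_real lam0) ** W t\<close> is
  Hermitian.\<close>

lemma mat_commute: "mat c ** A = A ** mat c" for c :: "'a::comm_semiring_1" and A :: "'a^'n^'n"
proof -
  have "mat c ** A = (\<chi> i j. c * A $ i $ j)"
    by (simp add: mat_def matrix_matrix_mult_def vec_eq_iff if_distrib if_distribR sum.delta' cong: if_cong)
  moreover have "A ** mat c = (\<chi> i j. c * A $ i $ j)"
    by (simp add: mat_def matrix_matrix_mult_def vec_eq_iff if_distrib if_distribR sum.delta' mult.commute cong: if_cong)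
  ultimately show ?thesis by simp
qed

lemma conj_transpose_matrix_inv:
  fixes A :: "complex^'n^'n"
  assumes "invertible A"
  shows "conj_transpose (matrix_inv A) = matrix_inv (conj_transpose A)"
  by (rule matrix_inv_unique[THEN sym])
    (metis assms conj_transpose_mat_1 conj_transpose_mult matrix_inv_left)

lemma invertible_conj_transpose: "invertible A \<Longrightarrow> invertible (conj_transpose A)"
  by (metis conj_transpose_mat_1 conj_transpose_mult invertible_def)

lemma hermitian_matrix_inv: "hermitian A \<Longrightarrow> invertible A \<Longrightarrow> hermitian (matrix_inv A)"
  by (simp add: hermitian_def conj_transpose_matrix_inv)

lemma hermitian_add: "hermitian A \<Longrightarrow> hermitian B \<Longrightarrow> hermitian (A + B)"
  by (simp add: hermitian_def conj_transpose_add)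

lemma hermitian_diff: "hermitian A \<Longrightarrow> hermitian B \<Longrightarrow> hermitian (A - B)"
  by (simp add: hermitian_def conj_transpose_diff)

section \<open>The sesquilinear form \<open>x\<^sup>* y\<close> and polarization\<close>

lemma cdot_add_right: "cdot x (y + z) = cdot x y + cdot x z"
  by (simp add: cdot_def distrib_left sum.distrib)

lemma cdot_diff_right: "cdot x (y - z) = cdot x y - cdot x z"
  by (simp add: cdot_def right_diff_distrib sum_subtractf)

lemma cdot_add_left: "cdot (x + y) z = cdot x z + cdot y z"
  by (simp add: cdot_def distrib_right sum.distrib)

lemma cdot_diff_left: "cdot (x - y) z = cdot x z - cdot y z"
  by (simp add: cdot_def left_diff_distrib sum_subtractf)

lemma cdot_zero: "cdot 0 x = 0" "cdot x 0 = 0"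
  by (simp_all add: cdot_def)

lemma cdot_smult: "cdot (c *s x) y = cnj c * cdot x y" "cdot x (c *s y) = c * cdot x y"
  by (simp_all add: cdot_def sum_distrib_left algebra_simps)

lemma cnj_cdot: "cnj (cdot x y) = cdot y x"
  by (simp add: cdot_def mult.commute)

lemma cdot_adjoint: "cdot x (M *v y) = cdot (conj_transpose M *v x) y"
proof -
  have "cdot x (M *v y) = (\<Sum>i\<in>UNIV. \<Sum>j\<in>UNIV. cnj (x $ i) * (M $ i $ j * y $ j))"
    by (simp add: cdot_def matrix_vector_mult_def sum_distrib_left)
  also have "\<dots> = (\<Sum>j\<in>UNIV. \<Sum>i\<in>UNIV. cnj (x $ i) * (M $ i $ j * y $ j))"
    by (rule sum.swap)
  also have "\<dots> = cdot (conj_transpose M *v x) y"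
    by (simp add: cdot_def matrix_vector_mult_def conj_transpose_def sum_distrib_left sum_distrib_right algebra_simps)
  finally show ?thesis .
qed

lemma cdot_pos: "x \<noteq> 0 \<Longrightarrow> 0 < cdot x x"
proof -
  assume "x \<noteq> 0"
  then obtain i where i: "x $ i \<noteq> 0" by (auto simp: vec_eq_iff)
  have e: "cdot x x = of_real (\<Sum>i\<in>UNIV. (cmod (x $ i))\<^sup>2)"
    unfolding cdot_def of_real_sum by (rule sum.cong) (simp_all only: complex_norm_square mult.commute)
  have "0 < (\<Sum>i\<in>UNIV. (cmod (x $ i))\<^sup>2)"
    using i by (intro sum_pos2[where i=i]) auto
  then show ?thesis unfolding e by (simp add: less_complex_def del: of_real_sum of_real_power)
qed

lemma hermitian_cdot_real:
  assumes "hermitian M"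
  shows "cdot x (M *v x) = of_real (Re (cdot x (M *v x)))"
proof -
  have "cnj (cdot x (M *v x)) = cdot x (M *v x)"
    using assms by (metis cdot_adjoint cnj_cdot hermitian_def)
  then show ?thesis by (simp add: complex_eq_iff)
qed

lemma cdot_axis:
  fixes M :: "complex^'n^'n"
  shows "cdot (axis i 1) (M *v axis j 1) = M $ i $ j"
proof -
  have *: "cdot (axis i 1) y = y $ i" for y :: "complex^'n"
    by (simp add: cdot_def axis_def if_distrib if_distribR sum.delta cong: if_cong)
  show ?thesis
    unfolding * by (simp add: matrix_vector_mult_def axis_def if_distrib sum.delta' cong: if_cong)
qed

text \<open>The form is conjugate-linear on the left, which fixes the signs of the imaginary terms.
  With \<open>cdot_axis\<close> it recovers the entries of a matrix from its quadratic form.\<close>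

lemma cdot_polarization:
  "4 * cdot x (M *v y) =
     cdot (x + y) (M *v (x + y)) - cdot (x - y) (M *v (x - y))
     - \<i> * cdot (x + \<i> *s y) (M *v (x + \<i> *s y)) + \<i> * cdot (x - \<i> *s y) (M *v (x - \<i> *s y))"
  by (simp add: cdot_add_left cdot_add_right cdot_diff_left cdot_diff_right matrix_vector_right_distrib
      matrix_vector_mult_diff_distrib cdot_smult vector_scalar_commute algebra_simps)

section \<open>Positive definite matrices\<close>

definition positive_definite :: "complex^'n^'n \<Rightarrow> bool" where
  "positive_definite M \<longleftrightarrow> hermitian M \<and> (\<forall>x. x \<noteq> 0 \<longrightarrow> 0 < cdot x (M *v x))"

lemma positive_definite_invertible: "positive_definite M \<Longrightarrow> invertible M"
  unfolding invertible_iff_kernel positive_definite_def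
  by (metis cdot_zero(2) less_irrefl)

lemma positive_definite_add:
  "positive_definite M \<Longrightarrow> positive_definite N \<Longrightarrow> positive_definite (M + N)"
  by (simp add: positive_definite_def hermitian_add matrix_vector_mult_add_rdistrib cdot_add_right
      add_pos_pos)

text \<open>The substitution \<open>x = M y\<close> turns the form of the inverse at
  \<open>x\<close> into the form of \<open>M\<close> at \<open>y\<close>.\<close>

lemma positive_definite_matrix_inv:
  assumes "positive_definite M"
  shows "positive_definite (matrix_inv M)"
proof -
  have inv: "invertible M" by (rule positive_definite_invertible[OF assms])
  have "0 < cdot x (matrix_inv M *v x)" if "x \<noteq> 0" for x
  proof -
    let ?y = "matrix_inv M *v x"
    have x: "M *v ?y = x"
      by (simp add: matrix_vector_mul_assoc matrix_inv_right inv)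
    then have "?y \<noteq> 0" using that by auto
    then have "0 < cdot ?y (M *v ?y)" using assms positive_definite_def by blast
    then show ?thesis
      by (metis assms cdot_adjoint hermitian_def positive_definite_def x)
  qed
  then show ?thesis
    using assms inv by (simp add: positive_definite_def hermitian_matrix_inv)
qed

text \<open>If the form vanished at some \<open>x \<noteq> 0\<close>, a small step from
  \<open>x\<close> in the direction \<open>- M x\<close>, which is nonzero, would make it
  negative.\<close>

lemma nonneg_definite_invertible_imp_positive_definite:
  assumes "nonneg_definite M" "invertible M"
  shows "positive_definite M"
proof -
  have H: "conj_transpose M = M" using assms(1) by (simp add: nonneg_definite_def hermitian_def)
  have "cdot x (M *v x) \<noteq> 0" if "x \<noteq> 0" for x
  proof
    assume z: "cdot x (M *v x) = 0"
    define y where "y = M *v x"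
    have y0: "y \<noteq> 0" using that assms(2) unfolding invertible_iff_kernel y_def by blast
    define q r where "q = Re (cdot y (M *v y))" and "r = Re (cdot y y)"
    have r: "r > 0" "cdot y y = of_real r"
      using cdot_pos[OF y0] by (auto simp: r_def less_complex_def complex_eq_iff)
    have q: "cdot y (M *v y) = of_real q"
      using hermitian_cdot_real assms(1) unfolding q_def nonneg_definite_def by blast
    \<comment> \<open>The constant term vanishes by \<open>z\<close>, and each of the two cross
      terms contributes \<open>- s * r\<close>.\<close>
    have e: "Re (cdot (x - of_real s *s y) (M *v (x - of_real s *s y))) = s\<^sup>2 * q - 2 * s * r" for s
    proof -
      have "cdot y (M *v x) = of_real r" using r y_def by simp
      moreover have "cdot x (M *v y) = of_real r" using r y_def H cdot_adjoint by metis
      ultimately show ?thesis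
        by (simp add: cdot_diff_left cdot_diff_right matrix_vector_mult_diff_distrib z q cdot_smult
            vector_scalar_commute power2_eq_square algebra_simps)
    qed
    have ge: "0 \<le> s\<^sup>2 * q - 2 * s * r" for s
      unfolding e[symmetric] using assms(1) by (simp add: nonneg_definite_def less_eq_complex_def)
    have q0: "q \<ge> 0" using assms(1) by (simp add: nonneg_definite_def less_eq_complex_def q_def)
    \<comment> \<open>The denominator \<open>q + 1\<close> also covers \<open>q = 0\<close>. It
      gives \<open>s * q \<le> r\<close>, so the quadratic is at most
      \<open>- s * r < 0\<close>.\<close>
    define s where "s = r / (q + 1)"
    have "s > 0" using r q0 by (simp add: s_def)
    moreover have "s * q \<le> r" using r q0 by (simp add: s_def field_simps)
    moreover have "s * (s * q) \<le> s * r" using calculation by (intro mult_left_mono) auto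
    moreover have "s * r > 0" using r \<open>s > 0\<close> by simp
    ultimately show False using ge[of s] unfolding power2_eq_square mult.assoc by linarith
  qed
  then show ?thesis
    using assms(1) unfolding positive_definite_def nonneg_definite_def
    by (metis order.not_eq_order_implies_strict)
qed

text \<open>The variational formula \<open>c\<^sup>* P\<inverse> c = max\<^sub>x (2 Re (c\<^sup>* x) - x\<^sup>* P x)\<close>, evaluated at \<open>x = Q\<inverse> c\<close>.\<close>

lemma positive_definite_matrix_inv_antimono:
  assumes P: "positive_definite P" and QP: "positive_definite (Q - P)"
  shows "positive_definite (matrix_inv P - matrix_inv Q)"
proof -
  have Q: "positive_definite Q" using positive_definite_add[OF P QP] by simp
  have iP: "invertible P" and iQ: "invertible Q"
    using P Q positive_definite_invertible by auto
  have HP: "conj_transpose P = P" and HQ: "conj_transpose Q = Q"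
    using P Q by (auto simp: positive_definite_def hermitian_def)
  have "0 < cdot c ((matrix_inv P - matrix_inv Q) *v c)" if "c \<noteq> 0" for c
  proof -
    define x where "x = matrix_inv Q *v c"
    define y where "y = matrix_inv P *v c"
    have Qx: "Q *v x = c" unfolding x_def by (simp add: matrix_vector_mul_assoc matrix_inv_right iQ)
    have Py: "P *v y = c" unfolding y_def by (simp add: matrix_vector_mul_assoc matrix_inv_right iP)
    have x0: "x \<noteq> 0" using Qx that by auto
    have 1: "0 < cdot x ((Q - P) *v x)" using QP x0 positive_definite_def by blast
    have 2: "0 \<le> cdot (y - x) (P *v (y - x))"
      using P by (cases "y - x = 0") (auto simp: positive_definite_def cdot_zero intro: less_imp_le)
    have s1: "cdot c x = cdot x c" using HQ Qx cdot_adjoint by metis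
    have s2: "cdot x (P *v x) = cdot x c - cdot x ((Q - P) *v x)"
      by (simp add: matrix_vector_mult_diff_rdistrib cdot_diff_right Qx)
    have s3: "cdot y (P *v x) = cdot c x" using HP Py cdot_adjoint by metis
    have s4: "cdot y c = cdot c y" using HP Py cdot_adjoint by metis
    have "cdot (y - x) (P *v (y - x)) = cdot c y - cdot x c - cdot x ((Q - P) *v x)"
      by (simp add: matrix_vector_mult_diff_distrib cdot_diff_left cdot_diff_right Py s1 s2 s3 s4)
    \<comment> \<open>The difference of the two inverse forms is a nonnegative value of the form of
      \<open>P\<close> plus a positive value of the form of \<open>Q - P\<close>.\<close>
    then have "cdot c y - cdot c x = cdot (y - x) (P *v (y - x)) + cdot x ((Q - P) *v x)"
      using s1 by simp
    moreover have "cdot c ((matrix_inv P - matrix_inv Q) *v c) = cdot c y - cdot c x"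
      by (simp add: matrix_vector_mult_diff_rdistrib cdot_diff_right x_def y_def)
    ultimately show ?thesis using 1 2 by (simp add: add_nonneg_pos)
  qed
  moreover have "hermitian (matrix_inv P - matrix_inv Q)"
    using P Q iP iQ by (auto simp: positive_definite_def intro: hermitian_diff hermitian_matrix_inv)
  ultimately show ?thesis by (simp add: positive_definite_def)
qed

section \<open>Limits of matrices\<close>

lemma matrix_tendstoI:
  fixes M :: "'c \<Rightarrow> complex^'n^'m"
  assumes "\<And>i j. ((\<lambda>t. M t $ i $ j) \<longlongrightarrow> L $ i $ j) F"
  shows "(M \<longlongrightarrow> L) F"
  using assms by (intro vec_tendstoI) auto

lemma tendsto_matrix_mult:
  fixes M :: "'c \<Rightarrow> complex^'n^'m" and N :: "'c \<Rightarrow> complex^'p^'n"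
  assumes "(M \<longlongrightarrow> L) F" "(N \<longlongrightarrow> K) F"
  shows "((\<lambda>t. M t ** N t) \<longlongrightarrow> L ** K) F"
  using assms unfolding matrix_matrix_mult_def
  by (intro matrix_tendstoI) (auto intro!: tendsto_sum tendsto_mult tendsto_vec_nth)

lemma tendsto_conj_transpose:
  assumes "(M \<longlongrightarrow> L) F"
  shows "((\<lambda>t. conj_transpose (M t)) \<longlongrightarrow> conj_transpose L) F"
  using assms unfolding conj_transpose_def
  by (intro matrix_tendstoI) (auto intro!: tendsto_cnj tendsto_vec_nth)

lemma tendsto_cdot_matrix:
  fixes M :: "'c \<Rightarrow> complex^'n^'n"
  assumes "(M \<longlongrightarrow> L) F"
  shows "((\<lambda>t. cdot x (M t *v y)) \<longlongrightarrow> cdot x (L *v y)) F"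
  using assms unfolding cdot_def matrix_vector_mult_def
  by (auto intro!: tendsto_sum tendsto_mult tendsto_vec_nth tendsto_const)

lemma tendsto_det:
  fixes M :: "'c \<Rightarrow> complex^'n^'n"
  assumes "(M \<longlongrightarrow> L) F"
  shows "((\<lambda>t. det (M t)) \<longlongrightarrow> det L) F"
  using assms unfolding det_def
  by (auto intro!: tendsto_sum tendsto_mult tendsto_prod tendsto_vec_nth tendsto_const)

text \<open>The determinant is continuous and nonzero at the limit.\<close>

lemma eventually_invertible:
  fixes M :: "'c \<Rightarrow> complex^'n^'n"
  assumes "(M \<longlongrightarrow> L) F" "invertible L"
  shows "eventually (\<lambda>t. invertible (M t)) F"
  using tendsto_imp_eventually_ne[OF tendsto_det[OF assms(1)], of 0] assms(2)
  by (simp add: invertible_det_nz)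

text \<open>Cramer's rule expresses the entries of the inverse as quotients of determinants.\<close>

lemma tendsto_matrix_inv:
  fixes M :: "'c \<Rightarrow> complex^'n^'n"
  assumes M: "(M \<longlongrightarrow> L) F" and L: "invertible L"
  shows "((\<lambda>t. matrix_inv (M t)) \<longlongrightarrow> matrix_inv L) F"
proof (rule matrix_tendstoI)
  fix i j
  define cr where "cr = (\<lambda>A::complex^'n^'n. det (\<chi> a b. if b = i then axis j 1 $ a else A $ a $ b) / det A)"
  have cr: "matrix_inv A $ i $ j = cr A" if "invertible A" for A :: "complex^'n^'n"
  proof -
    have "A *v (matrix_inv A *v axis j 1) = axis j 1"
      by (simp add: matrix_vector_mul_assoc matrix_inv_right that)
    then have "matrix_inv A *v axis j 1 =
        (\<chi> k. det (\<chi> a b. if b = k then axis j 1 $ a else A $ a $ b) / det A)"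
      using cramer that invertible_det_nz by blast
    then have "(matrix_inv A *v axis j 1) $ i = cr A" by (simp add: cr_def)
    moreover have "(matrix_inv A *v axis j 1) $ i = matrix_inv A $ i $ j"
      by (simp add: matrix_vector_mult_def axis_def if_distrib sum.delta' cong: if_cong)
    ultimately show ?thesis by simp
  qed
  have "((\<lambda>t. cr (M t)) \<longlongrightarrow> cr L) F"
    unfolding cr_def using L M
    by (intro tendsto_divide tendsto_det M matrix_tendstoI)
      (auto simp: invertible_det_nz intro!: tendsto_vec_nth)
  \<comment> \<open>\<open>cr\<close> is the entry of the inverse at invertible matrices only, and
    \<open>M t\<close> is eventually one of these.\<close>
  moreover have "eventually (\<lambda>t. cr (M t) = matrix_inv (M t) $ i $ j) F"
    using eventually_invertible[OF M L] by eventually_elim (simp add: cr)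
  ultimately have "((\<lambda>t. matrix_inv (M t) $ i $ j) \<longlongrightarrow> cr L) F"
    by (rule Lim_transform_eventually)
  then show "((\<lambda>t. matrix_inv (M t) $ i $ j) \<longlongrightarrow> matrix_inv L $ i $ j) F"
    by (simp add: cr[OF L])
qed

text \<open>Each quadratic form \<open>x\<^sup>* P t x\<close> is real, decreasing in
  \<open>t\<close> and bounded below by 0, hence convergent. Polarization passes the convergence to
  the entries.\<close>

lemma positive_definite_decreasing_limit:
  assumes P: "\<And>t. positive_definite (P t)"
    and dec: "\<And>t. positive_definite (P t - P (Suc t))"
  obtains T where "P \<longlonglongrightarrow> T" "hermitian T" "\<And>t. positive_definite (P t - T)"
proof -
  have H: "hermitian (P t)" for t using P positive_definite_def by blast
  define q where "q = (\<lambda>x t. Re (cdot x (P t *v x)))"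
  have qdec: "decseq (q x)" for x
  proof (rule decseq_SucI)
    fix t
    have "0 \<le> cdot x ((P t - P (Suc t)) *v x)"
      using dec[of t] by (cases "x = 0") (auto simp: positive_definite_def cdot_zero intro: less_imp_le)
    then show "q x (Suc t) \<le> q x t"
      by (simp add: q_def matrix_vector_mult_diff_rdistrib cdot_diff_right less_eq_complex_def)
  qed
  have q0: "0 \<le> q x t" for x t
    using P[of t] by (cases "x = 0")
      (auto simp: positive_definite_def cdot_zero q_def less_complex_def intro: less_imp_le)
  have "\<exists>l. q x \<longlonglongrightarrow> l" for x
    using decseq_convergent[OF qdec, of 0 x] q0 by metis
  then obtain l where l: "\<And>x. q x \<longlonglongrightarrow> l x" by metis
  have conv: "\<exists>m. (\<lambda>t. P t $ i $ j) \<longlonglongrightarrow> m" for i j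
  proof -
    let ?x = "axis i 1 :: complex^'a" and ?y = "axis j 1 :: complex^'a"
    have qe: "complex_of_real (q x t) = cdot x (P t *v x)" for x t
      unfolding q_def using hermitian_cdot_real[OF H] by simp
    have "P t $ i $ j = (q (?x + ?y) t - q (?x - ?y) t
        - \<i> * q (?x + \<i> *s ?y) t + \<i> * q (?x - \<i> *s ?y) t) / 4" for t
      using cdot_polarization[of ?x "P t" ?y]
      unfolding cdot_axis by (simp add: qe mult.commute)
    then have "(\<lambda>t. P t $ i $ j) = (\<lambda>t. (q (?x + ?y) t - q (?x - ?y) t
        - \<i> * q (?x + \<i> *s ?y) t + \<i> * q (?x - \<i> *s ?y) t) / 4)" by (rule ext)
    moreover have "(\<lambda>t. (q (?x + ?y) t - q (?x - ?y) t
        - \<i> * q (?x + \<i> *s ?y) t + \<i> * q (?x - \<i> *s ?y) t) / 4) \<longlonglongrightarrow> (l (?x + ?y) - l (?x - ?y)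
        - \<i> * l (?x + \<i> *s ?y) + \<i> * l (?x - \<i> *s ?y)) / 4"
      by (intro tendsto_intros l) simp
    ultimately have "(\<lambda>t. P t $ i $ j) \<longlonglongrightarrow> (l (?x + ?y) - l (?x - ?y)
        - \<i> * l (?x + \<i> *s ?y) + \<i> * l (?x - \<i> *s ?y)) / 4" by (simp only:)
    then show ?thesis ..
  qed
  then obtain m where m: "\<And>i j. (\<lambda>t. P t $ i $ j) \<longlonglongrightarrow> m i j" by metis
  define T where "T = (\<chi> i j. m i j)"
  have T: "P \<longlonglongrightarrow> T" by (rule matrix_tendstoI) (simp add: T_def m)
  have HT: "hermitian T"
  proof -
    have "(\<lambda>t. conj_transpose (P t)) = P" using H by (simp add: hermitian_def)
    then have "P \<longlonglongrightarrow> conj_transpose T" using tendsto_conj_transpose[OF T] by (simp only:)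
    then show ?thesis unfolding hermitian_def using T by (rule LIMSEQ_unique)
  qed
  have qT: "Re (cdot x (T *v x)) \<le> q x t" for x t
  proof (rule decseq_ge[OF qdec])
    show "q x \<longlonglongrightarrow> Re (cdot x (T *v x))"
      unfolding q_def by (intro tendsto_Re tendsto_cdot_matrix T)
  qed
  \<comment> \<open>Strictness comes from one further step: \<open>P t\<close> lies strictly above
    \<open>P (Suc t)\<close>, which lies weakly above the limit.\<close>
  have "positive_definite (P t - T)" for t
  proof -
    have "0 < cdot x ((P t - T) *v x)" if "x \<noteq> 0" for x
    proof -
      have "0 < cdot x ((P t - P (Suc t)) *v x)" using dec that positive_definite_def by blast
      then have "q x (Suc t) < q x t"
        by (simp add: q_def matrix_vector_mult_diff_rdistrib cdot_diff_right less_complex_def)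
      then have "0 < Re (cdot x ((P t - T) *v x))"
        using qT[of x "Suc t"] by (simp add: q_def matrix_vector_mult_diff_rdistrib cdot_diff_right)
      then show ?thesis
        using hermitian_cdot_real[OF hermitian_diff[OF H HT], of x t] by (simp add: less_complex_def complex_eq_iff)
    qed
    then show ?thesis by (simp add: positive_definite_def hermitian_diff H HT)
  qed
  then show thesis using that T HT by blast
qed


section \<open>Hamiltonian systems with positive definite coefficient\<close>

lemma UNIV_sum_split:
  fixes f :: "'a::finite + 'b::finite \<Rightarrow> 'c::comm_monoid_add"
  shows "(\<Sum>k\<in>UNIV. f k) = (\<Sum>a\<in>UNIV. f (Inl a)) + (\<Sum>b\<in>UNIV. f (Inr b))"
  unfolding UNIV_Plus_UNIV[symmetric] by (subst sum.Plus) simp_all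

text \<open>\<open>J_mat\<close> swaps the two blocks and negates the new upper one. This reduces
  the Wronskian to \<open>n\<close> by \<open>n\<close> blocks.\<close>

lemma stack_J_mat_stack:
  fixes U V U\<^sub>1 V\<^sub>1 :: "complex^'n^'n"
  shows "conj_transpose (stack U V) ** J_mat ** stack U\<^sub>1 V\<^sub>1 =
    conj_transpose V ** U\<^sub>1 - conj_transpose U ** V\<^sub>1"
proof -
  have "J_mat ** stack U\<^sub>1 V\<^sub>1 = stack (- V\<^sub>1) U\<^sub>1"
    by (simp add: vec_eq_iff matrix_matrix_mult_def UNIV_sum_split J_mat_def stack_def mat_def
        if_distrib if_distribR sum.delta sum.delta' sum_negf split: sum.split cong: if_cong)
  moreover have "conj_transpose (stack U V) ** stack X Y = conj_transpose U ** X + conj_transpose V ** Y"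
    for X Y :: "complex^'n^'n"
    by (simp add: vec_eq_iff matrix_matrix_mult_def UNIV_sum_split stack_def conj_transpose_def)
  ultimately show ?thesis
    by (simp add: matrix_mul_assoc[symmetric] matrix_minus_right)
qed

text \<open>Cancelling \<open>M\<close> on both sides of the Penrose equation
  \<open>M X M = M\<close> leaves only the inverse.\<close>

lemma moore_penrose_invertible:
  fixes M :: "complex^'n^'n"
  assumes M: "invertible M"
  shows "moore_penrose M = matrix_inv M"
  unfolding moore_penrose_def
proof (rule the_equality)
  show "is_moore_penrose M (matrix_inv M)"
    by (simp add: is_moore_penrose_def matrix_inv_left matrix_inv_right M conj_transpose_mat_1)
next
  fix X assume "is_moore_penrose M X"
  then have "matrix_inv M ** (M ** X ** M) ** matrix_inv M = matrix_inv M ** M ** matrix_inv M"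
    by (simp add: is_moore_penrose_def)
  then show "X = matrix_inv M"
    by (simp add: matrix_mul_assoc matrix_inv_left M) (simp add: matrix_inv_cancel M)
qed

text \<open>One-point subintervals already force \<open>B t\<close> to be injective.\<close>

lemma identically_normal_invertible:
  assumes "identically_normal A B"
  shows "invertible (B t)"
  unfolding invertible_iff_kernel
proof (intro allI impI)
  fix x assume x: "B t *v x = 0"
  \<comment> \<open>The value at \<open>Suc t\<close> is forced by the difference equation at
    \<open>t\<close>; elsewhere \<open>Lambda_space\<close> prescribes 0.\<close>
  define v where "v = (\<lambda>s. if s = t then x else if s = Suc t then x - conj_transpose (A t) *v x else 0)"
  have "v \<in> Lambda_space A B {t}"
    by (auto simp: Lambda_space_def v_def x)
  moreover have "subinterval {t}" by (simp add: subinterval_def)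
  ultimately have "v = (\<lambda>_. 0)"
    using assms by (auto simp: identically_normal_def normal_on_def)
  then show "x = 0" by (metis v_def)
qed

section \<open>Solutions and their Wronskians\<close>

locale hamiltonian_system =
  fixes A B C W :: "nat \<Rightarrow> complex^'n^'n" and lam0 :: real
  assumes invertible_D: "invertible (mat 1 - A t)"
    and B_pos: "positive_definite (B t)"
    and C_herm: "hermitian (C t)" and W_herm: "hermitian (W t)"
begin

abbreviation D :: "nat \<Rightarrow> complex^'n^'n" where "D t \<equiv> mat 1 - A t"
definition G :: "nat \<Rightarrow> complex^'n^'n" where "G t = C t - mat (of_real lam0) ** W t"
abbreviation solution :: "(nat \<Rightarrow> complex^'n^'n) \<Rightarrow> (nat \<Rightarrow> complex^'n^'n) \<Rightarrow> bool"
  where "solution U V \<equiv> mat_solution A B C W (of_real lam0) U V"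

lemma G_herm: "conj_transpose (G t) = G t"
  using C_herm[of t] W_herm[of t] mat_commute[of "of_real lam0" "W t"]
  by (simp add: G_def hermitian_def conj_transpose_simps conj_transpose_mat_of_real)

lemma B_herm: "conj_transpose (B t) = B t"
  using B_pos by (simp add: positive_definite_def hermitian_def)

lemma invertible_B: "invertible (B t)"
  by (rule positive_definite_invertible[OF B_pos])

lemma B_inv_herm: "conj_transpose (matrix_inv (B t)) = matrix_inv (B t)"
  by (simp add: conj_transpose_matrix_inv invertible_B B_herm)

text \<open>The recursive form: as \<open>D t\<close> is invertible, the first equation determines
  \<open>U (Suc t)\<close>, and the second then determines \<open>V (Suc t)\<close>.\<close>

lemma solution_iff:
  "solution U V \<longleftrightarrow> (\<forall>t. D t ** U (Suc t) = U t + B t ** V t \<and>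
     V (Suc t) = G t ** U (Suc t) + conj_transpose (D t) ** V t)"
proof -
  have *: "a - b = c + d \<longleftrightarrow> a - c = b + d" "a - b = c - d \<longleftrightarrow> a = c + (b - d)"
    for a b c d :: "complex^'n^'n"
    by (auto simp: algebra_simps)
  show ?thesis
    by (simp add: mat_solution_def G_def matrix_algebra conj_transpose_simps *)
qed

lemma solution_exists: "\<exists>U V. solution U V \<and> U 0 = P \<and> V 0 = Q"
proof -
  define step where "step = (\<lambda>t (X :: complex^'n^'n, Y :: complex^'n^'n).
    let X' = matrix_inv (D t) ** (X + B t ** Y) in (X', G t ** X' + conj_transpose (D t) ** Y))"
  define y where "y = rec_nat (P, Q) step"
  have "y (Suc t) = step t (y t)" for t by (simp add: y_def)
  then have s: "fst (y (Suc t)) = matrix_inv (D t) ** (fst (y t) + B t ** snd (y t))"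
    "snd (y (Suc t)) = G t ** fst (y (Suc t)) + conj_transpose (D t) ** snd (y t)" for t
    by (simp_all add: step_def Let_def split: prod.split)
  have "solution (fst \<circ> y) (snd \<circ> y)"
    unfolding solution_iff o_def s(2)
    by (simp add: s(1) matrix_inv_cancel invertible_D)
  moreover have "(fst \<circ> y) 0 = P" "(snd \<circ> y) 0 = Q" by (simp_all add: y_def)
  ultimately show ?thesis by blast
qed

lemma solution_mult_right:
  assumes "solution U V"
  shows "solution (\<lambda>t. U t ** N) (\<lambda>t. V t ** N)"
  using assms unfolding solution_iff matrix_mul_assoc matrix_add_rdistrib[symmetric] by simp

lemma vec_solution_of_solution:
  assumes "solution U V"
  shows "vec_solution A B C W (of_real lam0) (\<lambda>t. U t *v c) (\<lambda>t. V t *v c)"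
  using assms unfolding vec_solution_def mat_solution_def
  by (simp add: matrix_vector_mul_assoc flip: matrix_vector_mult_diff_rdistrib matrix_vector_mult_add_rdistrib)

text \<open>Lagrange's identity in two moves: the terms with \<open>G t\<close> cancel since
  \<open>G t\<close> is Hermitian, then those with \<open>B t\<close> for the same reason.\<close>

lemma wronskian_constant:
  assumes "solution U V" "solution U\<^sub>1 V\<^sub>1"
  shows "conj_transpose (V t) ** U\<^sub>1 t - conj_transpose (U t) ** V\<^sub>1 t =
    conj_transpose (V 0) ** U\<^sub>1 0 - conj_transpose (U 0) ** V\<^sub>1 0"
proof (induction t)
  case (Suc t)
  let ?U = "U (Suc t)" and ?U1 = "U\<^sub>1 (Suc t)"
  have s: "D t ** ?U = U t + B t ** V t" "V (Suc t) = G t ** ?U + conj_transpose (D t) ** V t"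
    "D t ** ?U1 = U\<^sub>1 t + B t ** V\<^sub>1 t" "V\<^sub>1 (Suc t) = G t ** ?U1 + conj_transpose (D t) ** V\<^sub>1 t"
    using assms unfolding solution_iff by blast+
  have "conj_transpose (V (Suc t)) ** ?U1 - conj_transpose ?U ** V\<^sub>1 (Suc t) =
      conj_transpose (V t) ** (D t ** ?U1) - conj_transpose (D t ** ?U) ** V\<^sub>1 t"
    unfolding s(2,4) conj_transpose_mult conj_transpose_add conj_transpose_conj_transpose G_herm
      matrix_add_ldistrib matrix_add_rdistrib matrix_mul_assoc by simp
  also have "\<dots> = conj_transpose (V t) ** U\<^sub>1 t - conj_transpose (U t) ** V\<^sub>1 t"
    unfolding s(1,3) conj_transpose_mult conj_transpose_add B_herm
      matrix_add_ldistrib matrix_add_rdistrib matrix_mul_assoc by simp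
  finally show ?case using Suc by simp
qed simp

text \<open>Wronskians against the rescaled solution gain the invertible left factor
  \<open>N\<^sup>*\<close>, and the limit only gains the right factor \<open>N\<close>. This allows
  a value to be normalized to the identity.\<close>

lemma recessive_solution_mult_right:
  assumes rec: "recessive_solution A B C W (of_real lam0) U V" and N: "invertible N"
  shows "recessive_solution A B C W (of_real lam0) (\<lambda>t. U t ** N) (\<lambda>t. V t ** N)"
proof -
  have w: "conj_transpose (stack (U t ** N) (V t ** N)) ** J_mat ** stack X Y =
      conj_transpose N ** (conj_transpose (stack (U t) (V t)) ** J_mat ** stack X Y)" for t X Y
    by (simp add: stack_J_mat_stack conj_transpose_mult matrix_diff_ldistrib matrix_mul_assoc)
  have w': "conj_transpose (stack X Y) ** J_mat ** stack (U t ** N) (V t ** N) =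
      (conj_transpose (stack X Y) ** J_mat ** stack (U t) (V t)) ** N" for t X Y
    by (simp add: stack_J_mat_stack matrix_diff_rdistrib matrix_mul_assoc)
  have prep: "prepared_solution A B C W (of_real lam0) U V"
    using rec recessive_solution_def by blast
  have iN: "invertible (conj_transpose N)" by (rule invertible_conj_transpose[OF N])
  have "prepared_solution A B C W (of_real lam0) (\<lambda>t. U t ** N) (\<lambda>t. V t ** N)"
    using prep unfolding prepared_solution_def w w'
    by (simp add: solution_mult_right times0_left times0_right)
  moreover have "\<exists>s\<^sub>1. (\<forall>t\<ge>s\<^sub>1. invertible (U\<^sub>1 t)) \<and> (\<lambda>t. matrix_inv (U\<^sub>1 t) ** (U t ** N)) \<longlonglongrightarrow> 0"
    if sol\<^sub>1: "solution U\<^sub>1 V\<^sub>1" and K: "invertible K"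
      and wK: "\<forall>t. conj_transpose (stack (U t ** N) (V t ** N)) ** J_mat ** stack (U\<^sub>1 t) (V\<^sub>1 t) = K"
    for U\<^sub>1 V\<^sub>1 K
  proof -
    have "\<forall>t. conj_transpose (stack (U t) (V t)) ** J_mat ** stack (U\<^sub>1 t) (V\<^sub>1 t) =
        matrix_inv (conj_transpose N) ** K"
      using wK unfolding w by (metis matrix_inv_cancel(1) iN)
    moreover have "invertible (matrix_inv (conj_transpose N) ** K)"
      by (simp add: invertible_mult invertible_matrix_inv iN K)
    ultimately obtain s\<^sub>1 where s: "\<forall>t\<ge>s\<^sub>1. invertible (U\<^sub>1 t)"
      "(\<lambda>t. matrix_inv (U\<^sub>1 t) ** U t) \<longlonglongrightarrow> 0"
      using rec sol\<^sub>1 unfolding recessive_solution_def by blast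
    have "(\<lambda>t. matrix_inv (U\<^sub>1 t) ** U t ** N) \<longlonglongrightarrow> 0 ** N"
      by (intro tendsto_matrix_mult s(2) tendsto_const)
    then show ?thesis using s(1) by (auto simp: times0_left matrix_mul_assoc)
  qed
  ultimately show ?thesis unfolding recessive_solution_def by blast
qed

end

section \<open>The solution vanishing at 0, and reduction of order\<close>

locale disconjugate_system = hamiltonian_system A B C W lam0
  for A B C W :: "nat \<Rightarrow> complex^'n^'n" and lam0 +
  fixes U0 V0 :: "nat \<Rightarrow> complex^'n^'n"
  assumes disconj: "disconjugate A B C W lam0"
    and sol0: "solution U0 V0" and U0_0: "U0 0 = 0" and V0_0: "V0 0 = mat 1"
begin

text \<open>\<open>c\<^sup>* X t c\<close> is the quantity whose sign is tested for a generalized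
  zero of \<open>U0 c\<close> at \<open>Suc t\<close>.\<close>

definition X :: "nat \<Rightarrow> complex^'n^'n" where
  "X t = conj_transpose (U0 t) ** matrix_inv (B t) ** D t ** U0 (Suc t)"

text \<open>The zero at 0 uses up the single generalized zero that disconjugacy allows.\<close>

lemma no_generalized_zero:
  assumes "0 < t"
  shows "\<not> generalized_zero A B (\<lambda>t. U0 t *v c) t"
proof
  assume "generalized_zero A B (\<lambda>t. U0 t *v c) t"
  moreover have "generalized_zero A B (\<lambda>t. U0 t *v c) 0"
    by (simp add: generalized_zero_def U0_0)
  ultimately have "t = 0"
    using disconj vec_solution_of_solution[OF sol0, of c] unfolding disconjugate_def by blast
  with assms show False by simp
qed

text \<open>\<open>(D t)\<inverse> B t\<close> is invertible, so its range is the whole space, and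
  the Moore-Penrose inverse of \<open>B t\<close> is the ordinary one.\<close>

lemma generalized_zero_Suc:
  "generalized_zero A B u (Suc t) \<longleftrightarrow>
     u t \<noteq> 0 \<and> cdot (u t) ((matrix_inv (B t) ** D t) *v u (Suc t)) \<le> 0"
proof -
  have "u (Suc t) = (matrix_inv (D t) ** B t) *v ((matrix_inv (B t) ** D t) *v u (Suc t))"
    by (simp add: matrix_vector_mul_assoc matrix_mul_assoc matrix_inv_cancel invertible_B
        matrix_inv_left invertible_D)
  then have "u (Suc t) \<in> range (\<lambda>x. (matrix_inv (D t) ** B t) *v x)" by blast
  then show ?thesis
    by (simp add: generalized_zero_def moore_penrose_invertible invertible_B)
qed

lemma U0_1: "U0 (Suc 0) = matrix_inv (D 0) ** B 0"
proof -
  have "D 0 ** U0 (Suc 0) = B 0"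
    using sol0 unfolding solution_iff by (metis U0_0 V0_0 add_0 matrix_mul_rid)
  then show ?thesis by (metis matrix_inv_cancel(1) invertible_D)
qed

text \<open>A kernel vector \<open>c\<close> at the next point makes the tested form 0 there. To
  avoid a generalized zero, \<open>U0 c\<close> must vanish one step earlier, and induction gives
  \<open>c = 0\<close>.\<close>

lemma invertible_U0: "invertible (U0 (Suc t))"
proof (induction t)
  case 0
  show ?case
    by (simp add: U0_1 invertible_mult invertible_matrix_inv invertible_D invertible_B)
next
  case (Suc t)
  show ?case
    unfolding invertible_iff_kernel
  proof (intro allI impI)
    fix c assume c: "U0 (Suc (Suc t)) *v c = 0"
    have "\<not> generalized_zero A B (\<lambda>t. U0 t *v c) (Suc (Suc t))"
      by (rule no_generalized_zero) simp
    then have "U0 (Suc t) *v c = 0"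
      by (simp add: generalized_zero_Suc c cdot_zero)
    then show "c = 0" using Suc unfolding invertible_iff_kernel by blast
  qed
qed

lemma B_inv_D_solution:
  assumes "solution U V"
  shows "matrix_inv (B t) ** D t ** U (Suc t) = matrix_inv (B t) ** U t + V t"
proof -
  have "D t ** U (Suc t) = U t + B t ** V t" using assms solution_iff by blast
  then show ?thesis
    by (metis matrix_mul_assoc matrix_add_ldistrib matrix_inv_cancel(1) invertible_B)
qed

text \<open>In the expansion \<open>e\<close> the first term is Hermitian because \<open>B t\<close>
  is. The second is Hermitian because the Wronskian of \<open>(U0; V0)\<close> with itself vanishes
  at 0.\<close>

lemma X_herm: "conj_transpose (X t) = X t"
proof -
  have e: "X t = conj_transpose (U0 t) ** matrix_inv (B t) ** U0 t + conj_transpose (U0 t) ** V0 t"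
    unfolding X_def using B_inv_D_solution[OF sol0]
    by (metis matrix_mul_assoc matrix_add_ldistrib)
  have "conj_transpose (V0 t) ** U0 t = conj_transpose (U0 t) ** V0 t"
    using wronskian_constant[OF sol0 sol0, of t]
    by (simp add: U0_0 V0_0 conj_transpose_simps matrix_algebra)
  then show ?thesis
    unfolding e by (simp add: conj_transpose_simps B_inv_herm matrix_mul_assoc)
qed

lemma X_pos: "positive_definite (X (Suc t))"
proof -
  have "0 < cdot c (X (Suc t) *v c)" if "c \<noteq> 0" for c
  proof -
    have "U0 (Suc t) *v c \<noteq> 0" using that invertible_U0 unfolding invertible_iff_kernel by blast
    moreover have "\<not> generalized_zero A B (\<lambda>t. U0 t *v c) (Suc (Suc t))"
      by (rule no_generalized_zero) simp
    ultimately have "\<not> cdot (U0 (Suc t) *v c)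
        ((matrix_inv (B (Suc t)) ** D (Suc t)) *v (U0 (Suc (Suc t)) *v c)) \<le> 0"
      by (simp add: generalized_zero_Suc)
    also have "cdot (U0 (Suc t) *v c)
        ((matrix_inv (B (Suc t)) ** D (Suc t)) *v (U0 (Suc (Suc t)) *v c)) = cdot c (X (Suc t) *v c)"
      using cdot_adjoint[of c "conj_transpose (U0 (Suc t))"]
      by (simp add: X_def matrix_vector_mul_assoc[symmetric] conj_transpose_simps)
    \<comment> \<open>In the complex order the negation of \<open>\<le> 0\<close> yields
      \<open>0 <\<close> only for real values; \<open>X_herm\<close> makes the value real.\<close>
    finally show ?thesis
      using hermitian_cdot_real[of "X (Suc t)" c] X_herm
      by (simp add: hermitian_def less_complex_def less_eq_complex_def complex_eq_iff)
  qed
  then show ?thesis by (simp add: positive_definite_def hermitian_def X_herm)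
qed

text \<open>The sum starts at \<open>X 1\<close> because \<open>X 0 = 0\<close>, as
  \<open>U0 0 = 0\<close>. In particular \<open>S 0 = 0\<close>.\<close>

definition S :: "nat \<Rightarrow> complex^'n^'n" where
  "S t = (\<Sum>s<t. matrix_inv (X (Suc s)))"

lemma S_pos: "positive_definite (S (Suc t))"
proof (induction t)
  case 0
  show ?case by (simp add: S_def positive_definite_matrix_inv X_pos)
next
  case (Suc t)
  have "S (Suc (Suc t)) = S (Suc t) + matrix_inv (X (Suc (Suc t)))" by (simp add: S_def)
  then show ?case using Suc by (simp add: positive_definite_add positive_definite_matrix_inv X_pos)
qed

text \<open>Since \<open>U0\<^sup>* V1 - V0\<^sup>* U1\<close> is constant, \<open>X \<Delta>(U0\<inverse> U1)\<close> is constant (reduction of order).\<close>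

lemma reduction_of_order:
  assumes sol: "solution U V"
  shows "U (Suc t) = U0 (Suc t) ** (matrix_inv (B 0) ** U 0 + V 0 - S t ** U 0)"
proof (induction t)
  case 0
  have "D 0 ** U (Suc 0) = U 0 + B 0 ** V 0" using sol solution_iff by blast
  then have "U (Suc 0) = matrix_inv (D 0) ** (U 0 + B 0 ** V 0)"
    by (metis matrix_inv_cancel(1) invertible_D)
  also have "\<dots> = U0 (Suc 0) ** (matrix_inv (B 0) ** U 0 + V 0)"
    by (simp add: U0_1 matrix_add_ldistrib matrix_mul_assoc matrix_inv_cancel invertible_B)
  finally show ?case by (simp add: S_def times0_left)
next
  case (Suc t)
  define r where "r = Suc t"
  define F where "F = matrix_inv (B 0) ** U 0 + V 0 - S t ** U 0"
  let ?H = "conj_transpose (U0 r)" and ?K = "matrix_inv (B r)"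
  have IH: "U r = U0 r ** F" using Suc by (simp add: r_def F_def)
  \<comment> \<open>Replacing \<open>X r\<close> by its adjoint puts \<open>U0 r\<close> next to
    \<open>F\<close>, where the induction hypothesis turns their product into
    \<open>U r\<close>.\<close>
  have XF: "X r ** F = conj_transpose (U0 (Suc r)) ** conj_transpose (D r) ** ?K ** U0 r ** F"
    by (subst X_herm[symmetric])
      (simp add: X_def conj_transpose_mult conj_transpose_conj_transpose B_inv_herm matrix_mul_assoc)
  have K0: "conj_transpose (U0 (Suc r)) ** conj_transpose (D r) ** ?K = ?H ** ?K + conj_transpose (V0 r)"
    using arg_cong[OF B_inv_D_solution[OF sol0, of r], of conj_transpose]
    by (simp only: conj_transpose_mult conj_transpose_add B_inv_herm matrix_mul_assoc)
  \<comment> \<open>The Wronskian is evaluated at 0, where \<open>U0\<close> is 0 and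
    \<open>V0\<close> is the identity.\<close>
  have "conj_transpose (V0 r) ** U r - ?H ** V r = U 0"
    using wronskian_constant[OF sol0 sol, of r]
    by (simp add: U0_0 V0_0 conj_transpose_simps matrix_algebra)
  moreover have "?H ** (?K ** D r ** U (Suc r)) = ?H ** ?K ** U r + ?H ** V r"
    unfolding B_inv_D_solution[OF sol] by (simp add: matrix_add_ldistrib matrix_mul_assoc)
  moreover have "X r ** F = ?H ** ?K ** U r + conj_transpose (V0 r) ** U r"
    unfolding XF K0 IH by (simp add: matrix_add_rdistrib matrix_mul_assoc)
  ultimately have 1: "?H ** (?K ** D r ** U (Suc r)) = X r ** F - U 0"
    by (simp add: algebra_simps)
  \<comment> \<open>With \<open>U = U0 Z\<close> at \<open>Suc r\<close>, the relation becomes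
    \<open>X r (Z - F) = - U 0\<close>, which is solved by inverting \<open>X r\<close>.\<close>
  define Z where "Z = matrix_inv (U0 (Suc r)) ** U (Suc r)"
  have Z: "U (Suc r) = U0 (Suc r) ** Z"
    by (simp add: Z_def matrix_inv_cancel r_def invertible_U0)
  have "X r ** Z = X r ** F - U 0"
    using 1 unfolding Z X_def by (simp only: matrix_mul_assoc)
  moreover have iX: "invertible (X r)"
    unfolding r_def by (rule positive_definite_invertible[OF X_pos])
  ultimately have "Z = F - matrix_inv (X r) ** U 0"
    by (metis matrix_inv_cancel(1) matrix_diff_ldistrib)
  moreover have "S (Suc t) = S t + matrix_inv (X r)" by (simp add: S_def r_def)
  ultimately have "Z = matrix_inv (B 0) ** U 0 + V 0 - S (Suc t) ** U 0"
    by (simp add: F_def matrix_add_rdistrib)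
  then show ?case using Z by (simp add: r_def)
qed

section \<open>Construction of the recessive solution\<close>

lemma recessive_solution_exists:
  "\<exists>U V. recessive_solution A B C W (of_real lam0) U V \<and> (\<forall>t\<ge>1. invertible (U t))"
proof -
  \<comment> \<open>The index is shifted because \<open>S 0 = 0\<close> is singular.\<close>
  define R where "R = (\<lambda>t. matrix_inv (S (Suc t)))"
  have R_pos: "positive_definite (R t)" for t
    unfolding R_def by (rule positive_definite_matrix_inv[OF S_pos])
  have R_dec: "positive_definite (R t - R (Suc t))" for t
    unfolding R_def
  proof (rule positive_definite_matrix_inv_antimono[OF S_pos])
    show "positive_definite (S (Suc (Suc t)) - S (Suc t))"
      by (simp add: S_def[of "Suc (Suc t)"] S_def[of "Suc t"] positive_definite_matrix_inv X_pos)
  qed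
  obtain T where T: "R \<longlonglongrightarrow> T" "hermitian T" "\<And>t. positive_definite (R t - T)"
    using positive_definite_decreasing_limit[of R, OF R_pos R_dec] by blast
  have HT: "conj_transpose T = T" using T(2) by (simp add: hermitian_def)
  have iS: "invertible (S (Suc t))" for t by (rule positive_definite_invertible[OF S_pos])
  have iE: "invertible (R t - T)" for t by (rule positive_definite_invertible[OF T(3)])
  \<comment> \<open>\<open>V 0\<close> is chosen to make \<open>(B 0)\<inverse> U 0 + V 0\<close>
    the identity, so reduction of order gives \<open>U = U0 (I - S T)\<close>.\<close>
  obtain U V where sol: "solution U V" and U_0: "U 0 = T" and V_0: "V 0 = mat 1 - matrix_inv (B 0) ** T"
    using solution_exists by blast
  have U_Suc: "U (Suc t) = U0 (Suc t) ** (mat 1 - S t ** T)" for t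
    using reduction_of_order[OF sol, of t] by (simp add: U_0 V_0)
  have SRT: "mat 1 - S (Suc t) ** T = S (Suc t) ** (R t - T)" for t
    by (simp add: R_def matrix_diff_ldistrib matrix_inv_right iS)
  have U_Suc_Suc: "U (Suc (Suc t)) = U0 (Suc (Suc t)) ** S (Suc t) ** (R t - T)" for t
    unfolding U_Suc SRT by (simp add: matrix_mul_assoc)
  have iU: "invertible (U t)" if "t \<ge> 1" for t
  \<comment> \<open>At \<open>t = 1\<close> the factor \<open>I - S 0 T\<close> is the identity; the
    factorization through \<open>R\<close> starts at \<open>t = 2\<close>.\<close>
  proof (cases "t = 1")
    case True
    then have "U t = U0 (Suc 0)" using U_Suc[of 0] by (simp add: S_def times0_left)
    then show ?thesis by (simp only: invertible_U0)
  next
    case False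
    define s where "s = t - 2"
    have "t = Suc (Suc s)" using False that by (simp add: s_def)
    then show ?thesis by (simp only: U_Suc_Suc invertible_mult invertible_U0 iS iE)
  qed
  \<comment> \<open>At 0 both terms of the Wronskian equal \<open>T - T (B 0)\<inverse> T\<close>,
    since \<open>T\<close> is Hermitian.\<close>
  have prepared: "prepared_solution A B C W (of_real lam0) U V"
    using wronskian_constant[OF sol sol]
    by (simp add: prepared_solution_def sol stack_J_mat_stack U_0 V_0 conj_transpose_simps HT
        B_inv_herm matrix_algebra)
  have "\<exists>s\<^sub>1. (\<forall>t\<ge>s\<^sub>1. invertible (U\<^sub>1 t)) \<and> (\<lambda>t. matrix_inv (U\<^sub>1 t) ** U t) \<longlonglongrightarrow> 0"
    if sol1: "solution U\<^sub>1 V\<^sub>1" and K: "invertible K"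
      and w: "\<And>t. conj_transpose (stack (U t) (V t)) ** J_mat ** stack (U\<^sub>1 t) (V\<^sub>1 t) = K"
    for U\<^sub>1 V\<^sub>1 K
  proof -
    define M where "M = matrix_inv (B 0) ** U\<^sub>1 0 + V\<^sub>1 0"
    define Q where "Q = (\<lambda>t. (R t - T) ** M - K)"
    \<comment> \<open>The Wronskian at 0 expresses \<open>U\<^sub>1 0\<close> as
      \<open>K + T M\<close>. Inserted into reduction of order, this produces the factor
      \<open>Q\<close>.\<close>
    have "K = U\<^sub>1 0 - T ** M"
      using w[of 0] by (simp add: stack_J_mat_stack U_0 V_0 conj_transpose_simps HT B_inv_herm
          matrix_algebra M_def algebra_simps)
    then have "M - S (Suc t) ** U\<^sub>1 0 = S (Suc t) ** Q t" for t
      by (simp add: Q_def R_def matrix_algebra matrix_inv_right iS)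
    then have U1: "U\<^sub>1 (Suc (Suc t)) = U0 (Suc (Suc t)) ** S (Suc t) ** Q t" for t
      using reduction_of_order[OF sol1, of "Suc t"] by (simp add: M_def matrix_mul_assoc)
    have E0: "(\<lambda>t. R t - T) \<longlonglongrightarrow> 0" using T(1) LIM_zero by blast
    have Q_lim: "Q \<longlonglongrightarrow> 0 ** M - K"
      unfolding Q_def by (intro tendsto_diff tendsto_matrix_mult E0 tendsto_const)
    \<comment> \<open>The limit of \<open>Q\<close> is \<open>- K\<close>, so the nonsingularity of
      the Wronskian makes \<open>Q t\<close> eventually invertible.\<close>
    have iK: "invertible (0 ** M - K)"
      using K unfolding invertible_iff_kernel times0_left matrix_vector_mult_diff_rdistrib by simp
    obtain N where N: "\<And>t. t \<ge> N \<Longrightarrow> invertible (Q t)"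
      using eventually_invertible[OF Q_lim iK] unfolding eventually_sequentially by blast
    have inv: "invertible (U\<^sub>1 t)" if "t \<ge> N + 2" for t
    proof -
      define s where "s = t - 2"
      have "t = Suc (Suc s)" "s \<ge> N" using that by (auto simp: s_def)
      then show ?thesis by (simp only: U1 invertible_mult invertible_U0 iS N)
    qed
    \<comment> \<open>\<open>U\<close> and \<open>U\<^sub>1\<close> share the invertible left factor
      \<open>U0 S\<close>, which cancels in the quotient.\<close>
    have eq: "matrix_inv (Q t) ** (R t - T) = matrix_inv (U\<^sub>1 (t + 2)) ** U (t + 2)" if "t \<ge> N" for t
    proof -
      have "U\<^sub>1 (t + 2) ** (matrix_inv (Q t) ** (R t - T)) = U (t + 2)"
        by (simp add: U1 U_Suc_Suc matrix_mul_assoc matrix_inv_cancel N that)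
      then have "matrix_inv (U\<^sub>1 (t + 2)) ** (U\<^sub>1 (t + 2) ** (matrix_inv (Q t) ** (R t - T))) =
          matrix_inv (U\<^sub>1 (t + 2)) ** U (t + 2)" by simp
      then show ?thesis using inv[of "t + 2"] that by (simp add: matrix_inv_cancel(1))
    qed
    have ev: "eventually (\<lambda>t. matrix_inv (Q t) ** (R t - T) = matrix_inv (U\<^sub>1 (t + 2)) ** U (t + 2)) sequentially"
      by (rule eventually_sequentiallyI[of N]) (rule eq)
    have "(\<lambda>t. matrix_inv (Q t) ** (R t - T)) \<longlonglongrightarrow> 0"
      using tendsto_matrix_mult[OF tendsto_matrix_inv[OF Q_lim iK] E0] unfolding times0_right .
    then have "(\<lambda>t. matrix_inv (U\<^sub>1 (t + 2)) ** U (t + 2)) \<longlonglongrightarrow> 0"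
      using ev by (rule Lim_transform_eventually)
    then have "(\<lambda>t. matrix_inv (U\<^sub>1 t) ** U t) \<longlonglongrightarrow> 0" by (rule LIMSEQ_offset)
    then show ?thesis using inv by blast
  qed
  then have "recessive_solution A B C W (of_real lam0) U V"
    unfolding recessive_solution_def using prepared by blast
  then show ?thesis using iU by blast
qed

end

theorem theorem3p6:
  fixes A B C W :: "nat \<Rightarrow> complex^'n^'n" and lam0 :: real and t\<^sub>1 :: nat
  assumes "\<And>t. invertible (mat 1 - A t)"
    and "\<And>t. hermitian (B t)" and "\<And>t. hermitian (C t)" and "\<And>t. hermitian (W t)"
    and "\<And>t. nonneg_definite (B t)" and "\<And>t. nonneg_definite (W t)"
    and "disconjugate A B C W lam0"
    and "identically_normal A B"
    and "t\<^sub>1 \<ge> 1"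
  shows "\<exists>U V. recessive_solution A B C W (of_real lam0) U V \<and>
               U t\<^sub>1 = mat 1 \<and> (\<forall>t\<ge>t\<^sub>1. invertible (U t))"
proof -
  interpret hamiltonian_system A B C W lam0
    using assms
    by unfold_locales
      (auto intro: nonneg_definite_invertible_imp_positive_definite identically_normal_invertible)
  obtain U0 V0 where "solution U0 V0" "U0 0 = 0" "V0 0 = mat 1"
    using solution_exists by blast
  then interpret disconjugate_system A B C W lam0 U0 V0
    using assms by unfold_locales auto
  obtain U V where UV: "recessive_solution A B C W (of_real lam0) U V"
    and iU: "\<And>t. t \<ge> 1 \<Longrightarrow> invertible (U t)"
    using recessive_solution_exists by blast
  \<comment> \<open>Available for every \<open>t\<^sub>1 \<ge> 1\<close>, because \<open>U\<close>
    is invertible from 1 onwards.\<close>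
  let ?N = "matrix_inv (U t\<^sub>1)"
  have N: "invertible ?N" using iU assms(9) by (simp add: invertible_matrix_inv)
  have "recessive_solution A B C W (of_real lam0) (\<lambda>t. U t ** ?N) (\<lambda>t. V t ** ?N)"
    by (rule recessive_solution_mult_right[OF UV N])
  moreover have "U t\<^sub>1 ** ?N = mat 1" using iU assms(9) by (simp add: matrix_inv_right)
  moreover have "\<forall>t\<ge>t\<^sub>1. invertible (U t ** ?N)"
    using iU assms(9) N by (simp add: invertible_mult)
  ultimately show ?thesis by (intro exI[of _ "\<lambda>t. U t ** ?N"] exI[of _ "\<lambda>t. V t ** ?N"] conjI)
qed

end
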